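(* Let $\mathcal F$ be the set of all $C$-convex and $C$-lower semicontinuous functions $f:X\to Y$, endowed with the topology of uniform convergence on bounded sets (induced by the distance $d$). Let $\tilde{\mathcal F}$ be the set of functions $f \in \mathcal F$ such that $\mathrm{Eff}(X, f)\neq\emptyset$ and the problem $(X,f)$ is DH-well-posed at some point $\bar x \in \mathrm{Eff}(X, f)$. Then $\tilde{\mathcal F}$ contains a dense $G_{\delta}$ subset of $\mathcal F$.
   Context: $X$ and $Y$ are (real) Banach spaces, and $C \subseteq Y$ is a closed, convex, pointed cone with nonempty interior. For $f:X\to Y$, the problem $(X,f)$ is the vector optimization problem $\min f(x)$, $x\in X$, with respect to the order $y_1\le_C y_2 \iff y_2-y_1\in C$. For $y\in Y$ put $L_f^C(y)=\{x\in X: f(x)\in y-C\}$. $f$ is $C$-convex if $f(tx+(1-t)z)\in tf(x)+(1-t)f(z)-C$ for all $x,z\in X$, $t\in[0,1]$. $f$ is $C$-lower semicontinuous if $L_f^C(y)$ is closed for every $y\in Y$. Efficient solutions: $\mathrm{Eff}(X,f)$ is the set of all $\bar x\in X$ such that $(f(X)-f(\bar x))\cap(-C)=\{0\}$. DH-well-posedness: the problem $(X,f)$ is DH-well-posed at $\bar x\in \mathrm{Eff}(X,f)$ if $\inf_{\alpha>0}\mathrm{diam}\, L_f^C(f(\bar x)+\alpha c)=0$ for every $c\in C$, where $\mathrm{diam}\,A=\sup\{\|x-y\|: x,y\in A\}$. Distance: fix $\theta\in X$; for $f,g\in\mathcal F$ and $i\in\mathbb N$ (with $i\ge 1$) set $\|f-g\|_i=\sup_{\|x-\theta\|\le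 i}\|f(x)-g(x)\|$. If $\|f-g\|_i=\infty$ for some $i$, set $d(f,g)=1$; otherwise $d(f,g)=\sum_{i=1}^\infty 2^{-i}\frac{\|f-g\|_i}{1+\|f-g\|_i}$. This distance is compatible with uniform convergence on bounded sets.
   Formalization: The formal statement additionally assumes Y ≠ {0}; for Y = {0} = C and X ≠ {0}, the only function is 0, every level set is all of X with infinite diameter, and the claim fails. *)

theory Defs
  imports "HOL-Analysis.Analysis"
begin

definition pointed_cone :: "'b::real_vector set \<Rightarrow> bool" where
  "pointed_cone C \<longleftrightarrow> cone C \<and> C \<inter> uminus ` C = {0}"

text \<open>The set \<open>y - C\<close>.\<close>

definition below :: "'b::real_vector set \<Rightarrow> 'b \<Rightarrow> 'b set" where
  "below C y = (\<lambda>c. y - c) ` C"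

definition level_set :: "'b::real_vector set \<Rightarrow> ('a \<Rightarrow> 'b) \<Rightarrow> 'b \<Rightarrow> 'a set" where
  "level_set C f y = {x. f x \<in> below C y}"

definition cone_convex :: "'b::real_vector set \<Rightarrow> ('a::real_vector \<Rightarrow> 'b) \<Rightarrow> bool" where
  "cone_convex C f \<longleftrightarrow>
    (\<forall>x z. \<forall>t\<in>{0..1}. f (t *\<^sub>R x + (1 - t) *\<^sub>R z) \<in> below C (t *\<^sub>R f x + (1 - t) *\<^sub>R f z))"

definition cone_lsc :: "'b::real_vector set \<Rightarrow> ('a::topological_space \<Rightarrow> 'b) \<Rightarrow> bool" where
  "cone_lsc C f \<longleftrightarrow> (\<forall>y. closed (level_set C f y))"

definition efficient :: "'b::real_vector set \<Rightarrow> ('a \<Rightarrow> 'b) \<Rightarrow> 'a set" where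
  "efficient C f = {xbar. range (\<lambda>x. f x - f xbar) \<inter> uminus ` C = {0}}"

text \<open>The library's \<^const>\<open>diameter\<close> is real-valued and says nothing about unbounded sets,
  so the diameter is taken with values in \<open>[0, \<infinity>]\<close>.\<close>

definition ediameter :: "'a::real_normed_vector set \<Rightarrow> ennreal" where
  "ediameter A = (SUP x\<in>A. SUP y\<in>A. ennreal (norm (x - y)))"

text \<open>Meaningful for points of \<^term>\<open>efficient C f\<close>.\<close>

definition DH_well_posed_at ::
    "'b::real_vector set \<Rightarrow> ('a::real_normed_vector \<Rightarrow> 'b) \<Rightarrow> 'a \<Rightarrow> bool" where
  "DH_well_posed_at C f xbar \<longleftrightarrow>
    (\<forall>c\<in>C. (INF \<alpha>\<in>{0::real<..}. ediameter (level_set C f (f xbar + \<alpha> *\<^sub>R c))) = 0)"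

definition ball_sup ::
    "'a::real_normed_vector \<Rightarrow> nat \<Rightarrow> ('a \<Rightarrow> 'b::real_normed_vector) \<Rightarrow> ('a \<Rightarrow> 'b) \<Rightarrow> ennreal" where
  "ball_sup \<theta> i f g = (SUP x\<in>{x. norm (x - \<theta>) \<le> real i}. ennreal (norm (f x - g x)))"

text \<open>The series is indexed from \<open>0\<close>, so that its term number \<open>i\<close> belongs to the radius \<open>i + 1\<close>.\<close>

definition bounded_dist ::
    "'a::real_normed_vector \<Rightarrow> ('a \<Rightarrow> 'b::real_normed_vector) \<Rightarrow> ('a \<Rightarrow> 'b) \<Rightarrow> real" where
  "bounded_dist \<theta> f g =
    (if \<exists>i\<ge>1. ball_sup \<theta> i f g = \<infinity> then 1
     else (\<Sum>i. (1/2) ^ Suc i *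
            (enn2real (ball_sup \<theta> (Suc i) f g) / (1 + enn2real (ball_sup \<theta> (Suc i) f g)))))"

definition convex_lsc_maps :: "'b::real_vector set \<Rightarrow> ('a::real_normed_vector \<Rightarrow> 'b) set" where
  "convex_lsc_maps C = {f. cone_convex C f \<and> cone_lsc C f}"

definition well_posed_maps :: "'b::real_vector set \<Rightarrow> ('a::real_normed_vector \<Rightarrow> 'b) set" where
  "well_posed_maps C =
    {f \<in> convex_lsc_maps C. efficient C f \<noteq> {} \<and> (\<exists>xbar\<in>efficient C f. DH_well_posed_at C f xbar)}"

text \<open>\<^const>\<open>Metric_space.mtopology\<close> yields the metric topology only for an actual metric;
  this is ensured by the lemma \<open>Metric_space_bounded_dist\<close> below.\<close>

definition map_topology ::
    "'a::real_normed_vector \<Rightarrow> 'b::real_normed_vector set \<Rightarrow> ('a \<Rightarrow> 'b) topology" where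
  "map_topology \<theta> C = Metric_space.mtopology (convex_lsc_maps C) (bounded_dist \<theta>)"

lemma ball_sup_commute: "ball_sup \<theta> i f g = ball_sup \<theta> i g f"
  by (simp add: ball_sup_def norm_minus_commute)

lemma ball_sup_upper: "norm (x - \<theta>) \<le> real i \<Longrightarrow> ennreal (norm (f x - g x)) \<le> ball_sup \<theta> i f g"
  unfolding ball_sup_def by (rule SUP_upper) simp

lemma ball_sup_triangle: "ball_sup \<theta> i f h \<le> ball_sup \<theta> i f g + ball_sup \<theta> i g h"
  unfolding ball_sup_def[of _ _ f h]
proof (rule SUP_least)
  fix x assume "x \<in> {x. norm (x - \<theta>) \<le> real i}"
  then have x: "norm (x - \<theta>) \<le> real i" by simp
  have "norm (f x - h x) \<le> norm (f x - g x) + norm (g x - h x)"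
    using norm_triangle_ineq[of "f x - g x" "g x - h x"] by simp
  then have "ennreal (norm (f x - h x)) \<le> ennreal (norm (f x - g x)) + ennreal (norm (g x - h x))"
    by (simp flip: ennreal_plus)
  also have "\<dots> \<le> ball_sup \<theta> i f g + ball_sup \<theta> i g h"
    by (intro add_mono ball_sup_upper x)
  finally show "ennreal (norm (f x - h x)) \<le> ball_sup \<theta> i f g + ball_sup \<theta> i g h" .
qed

lemma frac_bounds: "(0::real) \<le> a \<Longrightarrow> 0 \<le> a / (1 + a) \<and> a / (1 + a) \<le> 1"
  by (simp add: field_simps)

lemma frac_subadditive:
  fixes a b c :: real
  assumes "0 \<le> a" "0 \<le> b" "0 \<le> c" "a \<le> b + c"
  shows "a / (1 + a) \<le> b / (1 + b) + c / (1 + c)"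
proof -
  have "a / (1 + a) \<le> (b + c) / (1 + (b + c))"
    using assms by (simp add: field_simps)
  also have "\<dots> = b / (1 + (b + c)) + c / (1 + (b + c))"
    by (rule add_divide_distrib)
  also have "\<dots> \<le> b / (1 + b) + c / (1 + c)"
    using assms by (intro add_mono divide_left_mono) auto
  finally show ?thesis .
qed

lemma bounded_dist_term:
  fixes r :: real
  assumes "0 \<le> r"
  shows "0 \<le> (1/2) ^ n * (r / (1 + r))" "(1/2) ^ n * (r / (1 + r)) \<le> (1/2) ^ n"
   apply (rule mult_nonneg_nonneg; use frac_bounds[OF assms] in simp)
  apply (rule mult_left_le; use frac_bounds[OF assms] in simp)
  done

lemma bounded_dist_summable:
  fixes r :: "nat \<Rightarrow> ennreal"
  shows "summable (\<lambda>i. (1/2::real) ^ Suc i * (enn2real (r i) / (1 + enn2real (r i))))"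
proof (rule summable_comparison_test')
  show "summable (\<lambda>i. (1/2::real) ^ Suc i)"
    using sums_summable[OF power_half_series] .
  show "norm ((1/2::real) ^ Suc i * (enn2real (r i) / (1 + enn2real (r i)))) \<le> (1/2) ^ Suc i"
    if "0 \<le> i" for i
    using bounded_dist_term[of "enn2real (r i)" "Suc i"] by (simp only: real_norm_def abs_of_nonneg enn2real_nonneg)
qed

lemma bounded_dist_nonneg: "0 \<le> bounded_dist \<theta> f g"
proof -
  have "0 \<le> (\<Sum>i. (1/2::real) ^ Suc i * (enn2real (r i) / (1 + enn2real (r i))))"
    for r :: "nat \<Rightarrow> ennreal"
    by (rule suminf_nonneg[OF bounded_dist_summable bounded_dist_term(1)]) simp
  then show ?thesis
    unfolding bounded_dist_def by simp
qed

lemma bounded_dist_le_1: "bounded_dist \<theta> f g \<le> 1"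
proof -
  have "(\<Sum>i. (1/2::real) ^ Suc i * (enn2real (r i) / (1 + enn2real (r i)))) \<le> (\<Sum>i. (1/2) ^ Suc i)"
    for r :: "nat \<Rightarrow> ennreal"
    by (rule suminf_le[OF bounded_dist_term(2) bounded_dist_summable
          sums_summable[OF power_half_series]]) simp
  also have "(\<Sum>i. (1/2::real) ^ Suc i) = 1"
    using sums_unique[OF power_half_series] by simp
  finally show ?thesis
    unfolding bounded_dist_def by auto
qed

lemma bounded_dist_triangle:
  fixes f g h :: "'a::real_normed_vector \<Rightarrow> 'b::real_normed_vector"
  shows "bounded_dist \<theta> f h \<le> bounded_dist \<theta> f g + bounded_dist \<theta> g h"
proof (cases "(\<exists>i\<ge>1. ball_sup \<theta> i f g = \<infinity>) \<or> (\<exists>i\<ge>1. ball_sup \<theta> i g h = \<infinity>)")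
  case True
  then have "bounded_dist \<theta> f g = 1 \<or> bounded_dist \<theta> g h = 1"
    unfolding bounded_dist_def by auto
  then show ?thesis
    using bounded_dist_le_1[of \<theta> f h] bounded_dist_nonneg[of \<theta> f g] bounded_dist_nonneg[of \<theta> g h]
    by linarith
next
  case False
  then have fin: "ball_sup \<theta> i f g < \<infinity>" "ball_sup \<theta> i g h < \<infinity>" if "1 \<le> i" for i
    using that by (auto simp: less_top)
  then have fin': "ball_sup \<theta> i f h < \<infinity>" if "1 \<le> i" for i
    using le_less_trans[OF ball_sup_triangle[of \<theta> i f h g]] that by simp
  define s where "s u v i = enn2real (ball_sup \<theta> (Suc i) u v)" for u v :: "'a \<Rightarrow> 'b" and i
  have eq: "bounded_dist \<theta> u v = (\<Sum>i. (1/2) ^ Suc i * (s u v i / (1 + s u v i)))"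
    if "\<And>i. 1 \<le> i \<Longrightarrow> ball_sup \<theta> i u v < \<infinity>" for u v
    using that unfolding bounded_dist_def s_def by fastforce
  have eqs: "bounded_dist \<theta> f h = (\<Sum>i. (1/2) ^ Suc i * (s f h i / (1 + s f h i)))"
      "bounded_dist \<theta> f g = (\<Sum>i. (1/2) ^ Suc i * (s f g i / (1 + s f g i)))"
      "bounded_dist \<theta> g h = (\<Sum>i. (1/2) ^ Suc i * (s g h i / (1 + s g h i)))"
    by (rule eq, erule fin fin')+
  have sm: "summable (\<lambda>i. (1/2) ^ Suc i * (s u v i / (1 + s u v i)))" for u v
    unfolding s_def by (rule bounded_dist_summable)
  have s_tri: "s f h i \<le> s f g i + s g h i" for i
    using enn2real_mono[OF ball_sup_triangle[of \<theta> "Suc i" f h g]] fin[of "Suc i"]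
    unfolding s_def by (simp add: enn2real_plus)
  have "bounded_dist \<theta> f h \<le>
      (\<Sum>i. (1/2) ^ Suc i * (s f g i / (1 + s f g i)) + (1/2) ^ Suc i * (s g h i / (1 + s g h i)))"
    unfolding eqs(1)
  proof (rule suminf_le[OF _ sm summable_add[OF sm sm]])
    fix i
    have "s f h i / (1 + s f h i) \<le> s f g i / (1 + s f g i) + s g h i / (1 + s g h i)"
      by (rule frac_subadditive) (use s_tri in \<open>auto simp: s_def\<close>)
    then show "(1/2) ^ Suc i * (s f h i / (1 + s f h i)) \<le>
        (1/2) ^ Suc i * (s f g i / (1 + s f g i)) + (1/2) ^ Suc i * (s g h i / (1 + s g h i))"
      unfolding distrib_left[symmetric] by (rule mult_left_mono) simp
  qed
  also have "\<dots> = bounded_dist \<theta> f g + bounded_dist \<theta> g h"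
    unfolding eqs(2,3) by (rule suminf_add[OF sm sm, symmetric])
  finally show ?thesis .
qed

lemma bounded_dist_eq_0_iff: "bounded_dist \<theta> f g = 0 \<longleftrightarrow> f = g"
proof
  assume z: "bounded_dist \<theta> f g = 0"
  then have fin: "ball_sup \<theta> i f g < \<infinity>" if "1 \<le> i" for i
    using that unfolding bounded_dist_def by (auto simp: less_top split: if_splits)
  have "(\<Sum>i. (1/2::real) ^ Suc i *
      (enn2real (ball_sup \<theta> (Suc i) f g) / (1 + enn2real (ball_sup \<theta> (Suc i) f g)))) = 0"
    using z unfolding bounded_dist_def by (simp split: if_splits)
  then have "(1/2::real) ^ Suc i *
      (enn2real (ball_sup \<theta> (Suc i) f g) / (1 + enn2real (ball_sup \<theta> (Suc i) f g))) = 0" for i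
    by (subst (asm) suminf_eq_zero_iff[OF bounded_dist_summable]) auto
  moreover have "1 + enn2real (ball_sup \<theta> (Suc i) f g) > 0" for i
    by (simp add: add_pos_nonneg)
  ultimately have "enn2real (ball_sup \<theta> (Suc i) f g) = 0" for i
    by (metis divide_eq_0_iff less_irrefl mult_eq_0_iff power_eq_0_iff zero_neq_numeral zero_neq_one)
  then have "ball_sup \<theta> (Suc i) f g = 0" for i
    using fin[of "Suc i"] by (metis One_nat_def Suc_le_mono enn2real_eq_0_iff infinity_ennreal_def le0 less_irrefl)
  then have "norm (f x - g x) = 0" if "norm (x - \<theta>) \<le> real (Suc i)" for x i
    using ball_sup_upper[OF that, of f g] by simp
  moreover have "\<exists>i. norm (x - \<theta>) \<le> real (Suc i)" for x
    using real_arch_simple[of "norm (x - \<theta>)"] by (metis le_SucI of_nat_le_iff order.refl order_trans)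
  ultimately show "f = g"
    by (intro ext) (metis eq_iff_diff_eq_0 norm_eq_zero)
next
  assume "f = g"
  then have z: "ball_sup \<theta> i f g = 0" for i
    by (simp add: ball_sup_def SUP_constant bot_ennreal)
  show "bounded_dist \<theta> f g = 0"
    unfolding bounded_dist_def z by simp
qed

lemma Metric_space_bounded_dist: "Metric_space M (bounded_dist \<theta>)"
proof
  show "bounded_dist \<theta> f g = bounded_dist \<theta> g f" for f g
    unfolding bounded_dist_def ball_sup_commute[of \<theta> _ f g] by (rule refl)
qed (simp_all add: bounded_dist_nonneg bounded_dist_eq_0_iff bounded_dist_triangle)

end

theory Submission
  imports Defs
begin

text \<open>
  The vector problem is reduced to a scalar one. Fix an interior point \<open>e\<close> of the cone and let
  \<open>cone_gauge y\<close> be the least \<open>t\<close> with \<open>y \<in> t e - C\<close>. This functional is sublinear,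
  monotone for the order of \<open>C\<close> and Lipschitz, and it satisfies
  \<open>cone_gauge (y + t e) = cone_gauge y + t\<close>. For \<open>f\<close> in the space, the real function
  \<open>s = cone_gauge \<circ> f\<close> is therefore convex with closed sublevel sets. If the sublevel sets of \<open>s\<close>
  shrink to a point, then so do the level sets of \<open>f\<close> at that point, by monotonicity: the point is
  efficient and the vector problem is DH-well-posed there
  (\<open>well_posed_if_gauge_Tykhonov\<close>).

  For \<open>r > 0\<close>, consider the maps \<open>f\<close> such that some sphere of radius \<open>r\<close> has a centre \<open>a\<close> with
  \<open>s \<ge> s a + \<alpha>\<close> on the sphere, for some \<open>\<alpha> > 0\<close>. The condition
  concerns a bounded set only, so it is open for uniform convergence on bounded sets
  (\<open>openin_sphere_gap_maps\<close>). Yet it is a global statement: by convexity the gap persists outside the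
  sphere, hence the sublevel set of \<open>s\<close> at \<open>s a\<close> lies in the ball. If the condition
  holds for radii \<open>1, 1/2, 1/3, \<dots>\<close>, then these sublevel sets, which form a chain, meet in one
  point by completeness of the domain, and \<open>s\<close> is well-posed there
  (\<open>Tykhonov_well_posed_if_sphere_gaps\<close>). The required \<open>G\<^sub>\<delta>\<close> set is the intersection over these radii.

  It is dense because a perturbation \<open>f + h e\<close> with a scalar function \<open>h\<close> changes \<open>s\<close> into \<open>s + h\<close>.
  A convex function with closed sublevel sets decreases at most linearly, so a steep
  multiple of the distance to a large ball, which vanishes on that ball, makes \<open>s\<close> coercive and
  bounded below. Ekeland's principle then gives a point \<open>a\<close> at which adding a small multiple of
  \<open>dist x a\<close> produces a sharp minimum, and a sharp minimum has a gap on every sphere around it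
  (\<open>sharp_minimum_perturbation\<close>, \<open>sphere_gap_maps_dense\<close>).
\<close>

section \<open>Convex functions with closed sublevel sets\<close>

lemma convex_sphere_value:
  fixes s :: "'a::real_normed_vector \<Rightarrow> real"
  assumes "convex_on UNIV s" "0 < r" "r \<le> dist x a"
  obtains z where "dist z a = r" "s z \<le> s a + r / dist x a * (s x - s a)"
proof
  define t where "t = r / dist x a"
  define z where "z = (1 - t) *\<^sub>R a + t *\<^sub>R x"
  have t: "0 < t" "t \<le> 1"
    using assms(2,3) by (auto simp: t_def divide_le_eq_1 intro!: divide_pos_pos)
  have "z - a = t *\<^sub>R (x - a)"
    by (simp add: z_def algebra_simps)
  then show "dist z a = r"
    using assms(2,3) by (auto simp: dist_norm t_def)
  have "s z \<le> (1 - t) * s a + t * s x"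
    unfolding z_def using t by (intro convex_onD[OF assms(1)]) auto
  then show "s z \<le> s a + r / dist x a * (s x - s a)"
    by (simp add: t_def algebra_simps diff_divide_distrib)
qed

text \<open>Difference quotients of a convex function along a ray from \<open>a\<close> do not decrease, so what is
  known on the sphere is known farther out. This turns a condition on a bounded set into a global one.\<close>

lemma convex_gap_beyond_sphere:
  fixes s :: "'a::real_normed_vector \<Rightarrow> real"
  assumes conv: "convex_on UNIV s" and "0 < r" "0 \<le> \<alpha>" "r \<le> dist x a"
    and gap: "\<And>z. dist z a = r \<Longrightarrow> s a + \<alpha> \<le> s z"
  shows "s a + \<alpha> \<le> s x"
proof -
  obtain z where z: "dist z a = r" "s z \<le> s a + r / dist x a * (s x - s a)"
    using convex_sphere_value[OF conv \<open>0 < r\<close> \<open>r \<le> dist x a\<close>] .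
  define t where "t = r / dist x a"
  have t: "0 < t" "t \<le> 1"
    using assms(2,4) by (auto simp: t_def divide_le_eq_1 intro!: divide_pos_pos)
  have le: "\<alpha> \<le> t * (s x - s a)"
    using gap[OF z(1)] z(2) by (simp add: t_def)
  then have "0 \<le> s x - s a"
    using \<open>0 \<le> \<alpha>\<close> t by (metis order_trans zero_le_mult_iff not_le)
  then have "t * (s x - s a) \<le> s x - s a"
    using t by (simp add: mult_left_le_one_le)
  with le show ?thesis by simp
qed

lemma open_superlevel:
  fixes s :: "'a::topological_space \<Rightarrow> real"
  assumes "\<And>t. closed {x. s x \<le> t}"
  shows "open {x. u < s x}"
proof -
  have "{x. u < s x} = - {x. s x \<le> u}"
    by auto
  then show ?thesis
    using assms[of u] by (simp add: open_Compl)
qed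

text \<open>Near \<open>a\<close> the function stays above \<open>s a - 1\<close> because its superlevel sets are open; along each ray
  from \<open>a\<close> convexity extrapolates this bound with slope \<open>1 / q\<close>, where \<open>q\<close> is a radius on which
  it holds.\<close>

lemma convex_linear_growth_below:
  fixes s :: "'a::real_normed_vector \<Rightarrow> real"
  assumes conv: "convex_on UNIV s" and cl: "\<And>t. closed {x. s x \<le> t}"
  obtains b where "0 < b" "\<And>x. s a - 1 - b * dist x a \<le> s x"
proof -
  have "open {x. s a - 1 < s x}"
    using cl by (rule open_superlevel)
  then obtain r where r: "0 < r" "\<And>x. dist x a < r \<Longrightarrow> s a - 1 < s x"
    by (auto elim!: openE[of _ a] simp: subset_iff dist_commute)
  define q where "q = r / 2"
  have q: "0 < q" "\<And>x. dist x a \<le> q \<Longrightarrow> s a - 1 < s x"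
    using r by (auto simp: q_def)
  have "s a - 1 - (1 / q) * dist x a \<le> s x" for x
  proof (cases "dist x a \<le> q")
    case True
    have "0 \<le> (1 / q) * dist x a"
      using q(1) by simp
    with q(2)[OF True] show ?thesis by linarith
  next
    case False
    then obtain z where z: "dist z a = q" "s z \<le> s a + q / dist x a * (s x - s a)"
      using convex_sphere_value[OF conv q(1), of x a] by auto
    have "- 1 < q / dist x a * (s x - s a)"
      using z q(2)[of z] by simp
    moreover have "0 < dist x a"
      using False q(1) by linarith
    ultimately have "- dist x a < q * (s x - s a)"
      by (simp add: pos_less_divide_eq)
    then have "- dist x a / q < s x - s a"
      by (subst pos_divide_less_eq[OF q(1)]) (simp add: mult.commute)
    then show ?thesis by simp
  qed
  with q(1) show thesis
    by (intro that[of "1 / q"]) auto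
qed

text \<open>Closed sublevel sets express lower semicontinuity. The strict superlevel set of the sum is the
  union over \<open>u\<close> of the open sets where \<open>s > u\<close> and \<open>h > t - u\<close>.\<close>

lemma closed_sublevel_add:
  fixes s h :: "'a::topological_space \<Rightarrow> real"
  assumes "\<And>t. closed {x. s x \<le> t}" "continuous_on UNIV h"
  shows "closed {x. s x + h x \<le> t}"
proof -
  have "open {x. u < s x}" for u
    using assms(1) by (rule open_superlevel)
  moreover have "open {x. t - u < h x}" for u
    using assms(2) by (intro open_Collect_less continuous_intros)
  ultimately have "open (\<Union>u. {x. u < s x} \<inter> {x. t - u < h x})"
    by (intro open_UN open_Int ballI)
  also have "(\<Union>u. {x. u < s x} \<inter> {x. t - u < h x}) = - {x. s x + h x \<le> t}"
  proof -
    have "\<exists>u. u < s x \<and> t - u < h x" if "t < s x + h x" for x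
      by (rule exI[of _ "(s x + t - h x) / 2"]) (use that in \<open>simp add: field_simps\<close>)
    then show ?thesis by (fastforce simp: not_le)
  qed
  finally show ?thesis by (simp add: closed_def)
qed

text \<open>The sets \<open>S x = {y. s y + \<kappa> dist x y \<le> s x}\<close> are closed, contain \<open>x\<close>, and \<open>y \<in> S x\<close> implies
  \<open>S y \<subseteq> S x\<close>. Choosing each iterate nearly minimal for \<open>s\<close> on the set of its predecessor makes
  the diameters tend to \<open>0\<close>; the common point \<open>a\<close> then satisfies \<open>S a = {a}\<close>.\<close>

lemma Ekeland_variational_principle:
  fixes s :: "'a::complete_space \<Rightarrow> real"
  assumes cl: "\<And>t. closed {x. s x \<le> t}" and low: "\<And>x. m \<le> s x" and "0 < \<kappa>"
  obtains a where "s a \<le> s x0" "\<And>x. s a \<le> s x + \<kappa> * dist a x"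
proof -
  define S where "S x = {y. s y + \<kappa> * dist x y \<le> s x}" for x
  have bdd: "bdd_below (s ` A)" for A
    using low by (intro bdd_belowI[of _ m]) auto
  have self: "x \<in> S x" for x
    by (simp add: S_def)
  have sub: "S y \<subseteq> S x" if "y \<in> S x" for x y
  proof
    fix z assume "z \<in> S y"
    have "\<kappa> * dist x z \<le> \<kappa> * dist x y + \<kappa> * dist y z"
      using dist_triangle[of x z y] \<open>0 < \<kappa>\<close> by (simp flip: distrib_left)
    then show "z \<in> S x"
      using that \<open>z \<in> S y\<close> by (simp add: S_def)
  qed
  have "\<exists>f. \<forall>n::nat. (n = 0 \<longrightarrow> f n = x0) \<and>
      (f (Suc n) \<in> S (f n) \<and> s (f (Suc n)) < Inf (s ` S (f n)) + inverse (Suc n))"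
  proof (rule dependent_nat_choice)
    fix x and n :: nat
    have "\<exists>u\<in>s ` S x. u < Inf (s ` S x) + inverse (Suc n)"
      using self[of x] by (subst cInf_less_iff[symmetric]) (auto intro: bdd)
    then show "\<exists>y. (Suc n = 0 \<longrightarrow> y = x0) \<and> y \<in> S x \<and> s y < Inf (s ` S x) + inverse (Suc n)"
      by auto
  qed auto
  then obtain f where f0: "f 0 = x0" and f: "\<And>n. f (Suc n) \<in> S (f n)"
    "\<And>n. s (f (Suc n)) < Inf (s ` S (f n)) + inverse (Suc n)"
    by blast
  have anti: "S (f n) \<subseteq> S (f m)" if "m \<le> n" for m n
    using that by (rule lift_Suc_antimono_le[rotated]) (rule sub[OF f(1)])
  have near: "\<kappa> * dist (f (Suc n)) y < inverse (Suc n)" if "y \<in> S (f (Suc n))" for n y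
  proof -
    have "Inf (s ` S (f n)) \<le> s y"
      using that sub[OF f(1)] by (intro cInf_lower bdd) auto
    then show ?thesis
      using that f(2)[of n] by (auto simp: S_def)
  qed
  have "\<exists>a. \<Inter> (range (\<lambda>n. S (f n))) = {a}"
  proof (rule decreasing_closed_nest_sing)
    show "closed (S (f n))" for n
      unfolding S_def by (intro closed_sublevel_add cl continuous_intros)
    show "S (f n) \<noteq> {}" for n
      using self by auto
    show "S (f n) \<subseteq> S (f m)" if "m \<le> n" for m n
      using that by (rule anti)
    fix \<epsilon> :: real assume "0 < \<epsilon>"
    then obtain n where n: "inverse (Suc n) < \<kappa> * \<epsilon> / 2"
      using reals_Archimedean[of "\<kappa> * \<epsilon> / 2"] \<open>0 < \<kappa>\<close> by auto
    have "dist (f (Suc n)) y < \<epsilon> / 2" if "y \<in> S (f (Suc n))" for y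
    proof -
      have "\<kappa> * dist (f (Suc n)) y < \<kappa> * (\<epsilon> / 2)"
        using near[OF that] n by simp
      then show ?thesis using \<open>0 < \<kappa>\<close> by simp
    qed
    then show "\<exists>n. \<forall>x\<in>S (f n). \<forall>y\<in>S (f n). dist x y < \<epsilon>"
      using dist_triangle_half_r by blast
  qed
  then obtain a where a: "\<Inter> (range (\<lambda>n. S (f n))) = {a}" ..
  have "a \<in> S (f n)" for n
    using a by auto
  then have "S a \<subseteq> (\<Inter>n. S (f n))"
    using sub by blast
  then have "S a \<subseteq> {a}"
    using a by simp
  then have "s a \<le> s x + \<kappa> * dist a x" for x
    by (cases "x = a") (force simp: S_def)+
  moreover have "s a \<le> s x0"
  proof -
    have "0 \<le> \<kappa> * dist x0 a" using \<open>0 < \<kappa>\<close> by simp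
    then show ?thesis using \<open>\<And>n. a \<in> S (f n)\<close>[of 0] by (simp add: S_def f0)
  qed
  ultimately show thesis by (rule that[rotated])
qed

text \<open>The sublevel sets \<open>{x. s x \<le> s (a n)}\<close> at the centres of the spheres have radius at most
  \<open>1 / (n + 1)\<close> and, as sublevel sets of one function, form a chain. Their finite
  intersections \<open>T n\<close> are thus nonempty, and completeness yields the common point. That point satisfies
  \<open>s xbar \<le> s (a n)\<close> for all \<open>n\<close>, so the gap \<open>\<alpha> n\<close> controls the sublevel sets slightly above
  \<open>s xbar\<close> as well. The conclusion includes that \<open>xbar\<close> is the only minimizer.\<close>

lemma Tykhonov_well_posed_if_sphere_gaps:
  fixes s :: "'a::banach \<Rightarrow> real"
  assumes conv: "convex_on UNIV s" and cl: "\<And>t. closed {x. s x \<le> t}"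
    and gaps: "\<And>n. \<exists>a. \<exists>\<alpha>>0. \<forall>z. dist z a = inverse (real (Suc n)) \<longrightarrow> s a + \<alpha> \<le> s z"
  obtains xbar where "\<And>\<epsilon>. 0 < \<epsilon> \<Longrightarrow> \<exists>\<eta>>0. \<forall>x. s x < s xbar + \<eta> \<longrightarrow> dist x xbar < \<epsilon>"
proof -
  obtain a \<alpha> where pos: "\<And>n. 0 < \<alpha> n"
    and gap: "\<And>n z. dist z (a n) = inverse (real (Suc n)) \<Longrightarrow> s (a n) + \<alpha> n \<le> s z"
    using gaps by metis
  have near: "dist x (a n) < inverse (real (Suc n))" if "s x < s (a n) + \<alpha> n" for x n
  proof (rule ccontr)
    assume "\<not> ?thesis"
    then have "s (a n) + \<alpha> n \<le> s x"
      using pos[of n]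
      by (intro convex_gap_beyond_sphere[OF conv _ _ _ gap]) (auto simp: not_less)
    with that show False by simp
  qed
  have near2: "dist x y < \<epsilon>" if "s x < s (a n) + \<alpha> n" "s y < s (a n) + \<alpha> n"
    "inverse (real (Suc n)) < \<epsilon> / 2" for x y n \<epsilon>
    using near[OF that(1)] near[OF that(2)] that(3) by (metis dist_triangle_half_l order_less_trans)
  define T where "T n = {x. \<forall>k\<le>n. s x \<le> s (a k)}" for n
  have "\<exists>xbar. \<Inter> (range T) = {xbar}"
  proof (rule decreasing_closed_nest_sing)
    have "T n = (\<Inter>k\<in>{..n}. {x. s x \<le> s (a k)})" for n
      by (auto simp: T_def)
    then show "closed (T n)" for n
      using cl by auto
    show "T n \<noteq> {}" for n
    proof -
      \<comment> \<open>the lowest of the first centres lies in all the sublevel sets considered\<close>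
      have "arg_min_on (\<lambda>k. s (a k)) {..n} \<in> {..n}"
        by (rule arg_min_if_finite) auto
      moreover have "s (a (arg_min_on (\<lambda>k. s (a k)) {..n})) \<le> s (a k)" if "k \<le> n" for k
        by (rule arg_min_least) (use that in auto)
      ultimately show ?thesis
        unfolding T_def by blast
    qed
    show "T n \<subseteq> T m" if "m \<le> n" for m n
      using that by (auto simp: T_def)
    fix \<epsilon> :: real assume "0 < \<epsilon>"
    then obtain n where n: "inverse (real (Suc n)) < \<epsilon> / 2"
      using reals_Archimedean[of "\<epsilon> / 2"] by auto
    have "s x < s (a n) + \<alpha> n" if "x \<in> T n" for x
    proof -
      have "s x \<le> s (a n)"
        using that by (simp add: T_def)
      with pos[of n] show ?thesis by linarith
    qed
    then show "\<exists>n. \<forall>x\<in>T n. \<forall>y\<in>T n. dist x y < \<epsilon>"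
      using near2 n by blast
  qed
  then obtain xbar where "\<Inter> (range T) = {xbar}" ..
  then have xbar: "s xbar \<le> s (a n)" for n
    unfolding T_def by blast
  have "\<exists>\<eta>>0. \<forall>x. s x < s xbar + \<eta> \<longrightarrow> dist x xbar < \<epsilon>" if pos_eps: "0 < \<epsilon>" for \<epsilon>
  proof -
    obtain n where n: "inverse (real (Suc n)) < \<epsilon> / 2"
      using reals_Archimedean[OF half_gt_zero[OF pos_eps]] by blast
    have "dist x xbar < \<epsilon>" if "s x < s xbar + \<alpha> n" for x
      by (rule near2[OF _ _ n]) (use that xbar[of n] pos[of n] in auto)
    with pos[of n] show ?thesis by blast
  qed
  then show thesis by (rule that)
qed

text \<open>The perturbation is \<open>h = p + 2 \<kappa> dist a\<close>. The part \<open>p\<close> vanishes on the ball of radius \<open>N\<close> and has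
  slope \<open>b + 1\<close> outside, one more than the possible rate of decrease \<open>b\<close> of \<open>s\<close>; the point
  \<open>a\<close> comes from Ekeland's principle for \<open>s + p\<close> with constant \<open>\<kappa>\<close>. Of the slope
  \<open>2 \<kappa>\<close>, one half compensates the loss in that principle and the other makes the minimum sharp.
  The bound \<open>R0\<close> for the distance from \<open>a\<close> to \<open>\<theta>\<close> depends only on \<open>b\<close> and \<open>N\<close>, which is why \<open>\<kappa>\<close> can be chosen
  before \<open>a\<close> so that \<open>h \<le> \<delta>\<close> on the ball.\<close>

lemma sharp_minimum_perturbation:
  fixes s :: "'a::banach \<Rightarrow> real" and \<theta> :: 'a
  assumes conv: "convex_on UNIV s" and cl: "\<And>t. closed {x. s x \<le> t}"
    and "0 \<le> N" "0 < \<delta>"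
  obtains h a \<kappa> where "convex_on UNIV h" "continuous_on UNIV h" "\<And>x. 0 \<le> h x"
    "\<And>x. dist x \<theta> \<le> N \<Longrightarrow> h x \<le> \<delta>" "\<And>R. \<exists>B. \<forall>x. dist x \<theta> \<le> R \<longrightarrow> h x \<le> B"
    "0 < \<kappa>" "\<And>x. s a + h a + \<kappa> * dist x a \<le> s x + h x"
proof -
  obtain b where b: "0 < b" "\<And>x. s \<theta> - 1 - b * dist x \<theta> \<le> s x"
    using convex_linear_growth_below[OF conv cl] by blast
  define p where "p x = (b + 1) * max 0 (dist \<theta> x - N)" for x
  have p_conv: "convex_on UNIV p"
  proof -
    have "convex_on UNIV (\<lambda>x. max 0 (dist \<theta> x - N))"
    proof (rule convex_onI)
      fix t :: real and x y :: 'a assume t: "0 < t" "t < 1"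
      have "dist \<theta> ((1 - t) *\<^sub>R x + t *\<^sub>R y) \<le> (1 - t) * dist \<theta> x + t * dist \<theta> y"
        using t by (intro convex_onD[OF convex_on_dist[of UNIV]]) auto
      then have "dist \<theta> ((1 - t) *\<^sub>R x + t *\<^sub>R y) - N
          \<le> (1 - t) * (dist \<theta> x - N) + t * (dist \<theta> y - N)"
        by (simp add: algebra_simps)
      also have "\<dots> \<le> (1 - t) * max 0 (dist \<theta> x - N) + t * max 0 (dist \<theta> y - N)"
        using t by (intro add_mono mult_left_mono) auto
      finally show "max 0 (dist \<theta> ((1 - t) *\<^sub>R x + t *\<^sub>R y) - N)
          \<le> (1 - t) * max 0 (dist \<theta> x - N) + t * max 0 (dist \<theta> y - N)"
        using t by simp
    qed auto
    then show ?thesis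
      unfolding p_def using b by (intro convex_on_cmul) auto
  qed
  have p_cont: "continuous_on UNIV p"
    unfolding p_def by (intro continuous_intros)
  have p0: "0 \<le> p x" "dist x \<theta> \<le> N \<Longrightarrow> p x = 0" for x
    using b by (auto simp: p_def dist_commute)
  have low: "s \<theta> - 1 + dist x \<theta> - (b + 1) * N \<le> s x + p x" for x
  proof -
    have "(b + 1) * (dist x \<theta> - N) \<le> p x"
      unfolding p_def using b by (intro mult_left_mono) (auto simp: dist_commute)
    then show ?thesis
      using b(2)[of x] by (simp add: algebra_simps)
  qed
  define R0 where "R0 = 1 + (b + 1) * N"
  define \<kappa> where "\<kappa> = \<delta> / (2 * (N + R0))"
  have R0: "1 \<le> R0"
    using \<open>0 \<le> N\<close> b by (simp add: R0_def)
  have "0 < N + R0"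
    using R0 \<open>0 \<le> N\<close> by linarith
  then have \<kappa>: "0 < \<kappa>" "2 * \<kappa> * (N + R0) = \<delta>"
    using \<open>0 < \<delta>\<close> nonzero_divide_eq_eq[of "2 * (N + R0)" \<delta> \<kappa>]
    by (simp_all add: \<kappa>_def del: distrib_left_numeral)
  obtain a where a: "s a + p a \<le> s \<theta> + p \<theta>" "\<And>x. s a + p a \<le> s x + p x + \<kappa> * dist a x"
  proof (rule Ekeland_variational_principle[of "\<lambda>x. s x + p x"])
    show "closed {x. s x + p x \<le> t}" for t
      by (rule closed_sublevel_add[OF cl p_cont])
    show "s \<theta> - 1 - (b + 1) * N \<le> s x + p x" for x
      using low[of x] zero_le_dist[of x \<theta>] by linarith
  qed (use \<kappa> in auto)
  have "dist a \<theta> \<le> R0"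
    using a(1) low[of a] p0(2)[of \<theta>] \<open>0 \<le> N\<close> by (simp add: R0_def)
  define h where "h x = p x + 2 * \<kappa> * dist a x" for x
  have tri: "2 * \<kappa> * dist a x \<le> 2 * \<kappa> * (R + R0)" if "dist x \<theta> \<le> R" for x R
    using that \<open>dist a \<theta> \<le> R0\<close> \<kappa>(1) dist_triangle2[of a x \<theta>] by (intro mult_left_mono) auto
  show thesis
  proof (rule that[of h \<kappa> a])
    show "convex_on UNIV h"
      unfolding h_def using p_conv \<kappa> by (intro convex_on_add convex_on_cmul convex_on_dist) auto
    show "continuous_on UNIV h"
      unfolding h_def by (intro continuous_intros p_cont)
    show "0 \<le> h x" for x
      using p0(1)[of x] \<kappa> by (simp add: h_def)
    show "h x \<le> \<delta>" if "dist x \<theta> \<le> N" for x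
      using tri[OF that] p0(2)[OF that] \<kappa>(2) by (simp add: h_def)
    show "\<exists>B. \<forall>x. dist x \<theta> \<le> R \<longrightarrow> h x \<le> B" for R
    proof (intro exI allI impI)
      fix x assume x: "dist x \<theta> \<le> R"
      have "p x \<le> (b + 1) * max 0 (R - N)"
        unfolding p_def using b x by (intro mult_left_mono) (auto simp: dist_commute)
      then show "h x \<le> (b + 1) * max 0 (R - N) + 2 * \<kappa> * (R + R0)"
        using tri[OF x] by (simp add: h_def)
    qed
    show "0 < \<kappa>" by fact
    show "s a + h a + \<kappa> * dist x a \<le> s x + h x" for x
      using a(2)[of x] by (simp add: h_def dist_commute)
  qed
qed

section \<open>The distance and uniform closeness on balls\<close>

text \<open>One term of the series is enough: its weight is fixed once the radius is, and
  \<open>q / (1 + q) < \<kappa> / (1 + \<kappa>)\<close> forces \<open>q < \<kappa>\<close>. The radius \<open>r\<close> obtained is below \<open>1\<close>, which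
  excludes the exceptional value of the distance at infinite suprema.\<close>

lemma bounded_dist_less_imp_close_on_ball:
  assumes "0 < \<kappa>"
  obtains r where "0 < r"
    "\<And>f g :: 'a::real_normed_vector \<Rightarrow> 'b::real_normed_vector. \<And>x. bounded_dist \<theta> f g < r \<Longrightarrow> norm (x - \<theta>) \<le> R \<Longrightarrow> norm (f x - g x) < \<kappa>"
proof -
  obtain i where i: "R \<le> real (Suc i)"
    using real_arch_simple[of R] by (metis le_SucI of_nat_le_iff order.refl order_trans)
  define r :: real where "r = (1/2) ^ Suc i * (\<kappa> / (1 + \<kappa>))"
  have "0 < r"
    using assms by (simp add: r_def)
  have "r < 1"
  proof -
    have "r \<le> 1 * (\<kappa> / (1 + \<kappa>))"
      unfolding r_def using assms by (intro mult_right_mono power_le_one) auto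
    also have "\<dots> < 1"
      using assms by simp
    finally show ?thesis .
  qed
  have "norm (f x - g x) < \<kappa>" if d: "bounded_dist \<theta> f g < r" and x: "norm (x - \<theta>) \<le> R"
    for f g :: "'a \<Rightarrow> 'b" and x
  proof -
    define q where "q j = enn2real (ball_sup \<theta> (Suc j) f g)" for j
    define w where "w j = (1/2) ^ Suc j * (q j / (1 + q j))" for j
    have fin: "ball_sup \<theta> j f g < \<infinity>" if "1 \<le> j" for j
      using d \<open>r < 1\<close> that unfolding bounded_dist_def by (auto simp: less_top split: if_splits)
    have eq: "bounded_dist \<theta> f g = (\<Sum>j. w j)"
      using fin unfolding bounded_dist_def w_def q_def by (auto simp: less_le)
    have "summable w"
      unfolding w_def q_def by (rule bounded_dist_summable)
    moreover have nonneg: "0 \<le> w j" for j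
      unfolding w_def q_def by (rule bounded_dist_term) simp
    ultimately have "w i \<le> bounded_dist \<theta> f g"
      using sum_le_suminf[of w "{i}"] eq by simp
    then have "w i < r"
      using d by (rule order_le_less_trans)
    moreover have "0 < (1/2::real) ^ Suc i"
      by simp
    ultimately have "q i / (1 + q i) < \<kappa> / (1 + \<kappa>)"
      unfolding w_def r_def by (rule mult_left_less_imp_less[OF _ less_imp_le])
    moreover have "0 \<le> q i"
      by (simp add: q_def)
    ultimately have "q i < \<kappa>"
      using assms by (simp add: field_simps)
    moreover have "norm (f x - g x) \<le> q i"
    proof -
      have "ennreal (norm (f x - g x)) \<le> ball_sup \<theta> (Suc i) f g"
        using x i by (intro ball_sup_upper) simp
      then show ?thesis
        unfolding q_def using fin[of "Suc i"] by (metis enn2real_ennreal enn2real_mono infinity_ennreal_def le_add1 norm_ge_zero plus_1_eq_Suc)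
    qed
    ultimately show ?thesis by simp
  qed
  with \<open>0 < r\<close> show thesis by (rule that)
qed

text \<open>The first \<open>N\<close> terms belong to radii at most \<open>N\<close> and contribute at most \<open>\<delta>\<close>; the others are
  bounded by their weights, whose sum is \<open>(1/2) ^ N\<close>. Local boundedness of the difference keeps the
  distance in its series form.\<close>

lemma bounded_dist_le_if_close_on_ball:
  fixes f g :: "'a::real_normed_vector \<Rightarrow> 'b::real_normed_vector"
  assumes fin: "\<And>R. \<exists>B. \<forall>x. norm (x - \<theta>) \<le> R \<longrightarrow> norm (f x - g x) \<le> B"
    and close: "\<And>x. norm (x - \<theta>) \<le> real N \<Longrightarrow> norm (f x - g x) \<le> \<delta>" and "0 \<le> \<delta>"
  shows "bounded_dist \<theta> f g \<le> \<delta> + (1/2) ^ N"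
proof -
  define q where "q j = enn2real (ball_sup \<theta> (Suc j) f g)" for j
  define w where "w j = (1/2) ^ Suc j * (q j / (1 + q j))" for j
  have le: "ball_sup \<theta> i f g \<le> ennreal B"
    if "\<And>x. norm (x - \<theta>) \<le> real i \<Longrightarrow> norm (f x - g x) \<le> B" for i B
    unfolding ball_sup_def by (rule SUP_least) (use that in \<open>auto intro: ennreal_leI\<close>)
  have "ball_sup \<theta> i f g < \<infinity>" for i
  proof -
    obtain B where "\<And>x. norm (x - \<theta>) \<le> real i \<Longrightarrow> norm (f x - g x) \<le> B"
      using fin by blast
    then have "ball_sup \<theta> i f g \<le> ennreal B"
      by (rule le)
    also have "\<dots> < \<infinity>"
      by simp
    finally show ?thesis .
  qed
  then have eq: "bounded_dist \<theta> f g = (\<Sum>j. w j)"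
    unfolding bounded_dist_def w_def q_def by (auto simp: less_le)
  have half: "(\<lambda>j. (1/2::real) ^ Suc j) sums 1"
    by (rule power_half_series)
  have sm: "summable w"
    unfolding w_def q_def by (rule bounded_dist_summable)
  have "w j \<le> (1/2) ^ Suc j * \<delta>" if "j < N" for j
  proof -
    have "ball_sup \<theta> (Suc j) f g \<le> ennreal \<delta>"
      by (rule le, rule close) (use that in linarith)
    then have "q j \<le> \<delta>"
      unfolding q_def using \<open>0 \<le> \<delta>\<close> by (metis enn2real_leI)
    moreover have "q j / (1 + q j) \<le> q j"
      by (simp add: q_def divide_le_eq algebra_simps add_pos_nonneg)
    ultimately show ?thesis
      unfolding w_def by (intro mult_left_mono) auto
  qed
  then have "(\<Sum>j<N. w j) \<le> (\<Sum>j<N. (1/2) ^ Suc j * \<delta>)"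
    by (intro sum_mono) auto
  also have "\<dots> \<le> \<delta>"
  proof -
    have "(\<Sum>j<N. (1/2::real) ^ Suc j) \<le> 1"
      using sum_le_suminf[OF sums_summable[OF half], of "{..<N}"] sums_unique[OF half] by simp
    then show ?thesis
      unfolding sum_distrib_right[symmetric]
      using \<open>0 \<le> \<delta>\<close> by (intro mult_left_le_one_le sum_nonneg) auto
  qed
  finally have head: "(\<Sum>j<N. w j) \<le> \<delta>" .
  have tail_sums: "(\<lambda>j. (1/2::real) ^ N * (1/2) ^ Suc j) sums ((1/2) ^ N * 1)"
    by (rule sums_mult[OF half])
  have "w (j + N) \<le> (1/2) ^ N * (1/2) ^ Suc j" for j
    using bounded_dist_term(2)[of "q (j + N)" "Suc (j + N)"]
    by (simp add: w_def q_def power_add mult_ac)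
  then have "(\<Sum>j. w (j + N)) \<le> (1/2) ^ N"
    using suminf_le[OF _ summable_ignore_initial_segment[OF sm] sums_summable[OF tail_sums]]
      sums_unique[OF tail_sums] by simp
  with head show ?thesis
    unfolding eq suminf_split_initial_segment[OF sm, of N] by simp
qed

section \<open>Scalarization along an interior direction of the cone\<close>

lemma mem_below_iff: "x \<in> below C y \<longleftrightarrow> y - x \<in> C"
  by (force simp: below_def image_iff)

text \<open>The ball around \<open>e\<close> makes \<open>e\<close> an order unit, and \<open>- e \<notin> C\<close> is the only trace of pointedness:
  it keeps the scalarizing functional finite.\<close>

locale solid_cone =
  fixes C :: "'b::real_normed_vector set" and e :: 'b and \<rho> :: real
  assumes closed_C: "closed C"
    and add_C: "\<And>y z. y \<in> C \<Longrightarrow> z \<in> C \<Longrightarrow> y + z \<in> C"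
    and scale_C: "\<And>y t. y \<in> C \<Longrightarrow> 0 \<le> t \<Longrightarrow> t *\<^sub>R y \<in> C"
    and rho_pos: "0 < \<rho>"
    and ball_C: "\<And>v. norm v \<le> \<rho> \<Longrightarrow> e + v \<in> C"
    and minus_e: "- e \<notin> C"
begin

lemma e_in_C: "e \<in> C"
  using ball_C[of 0] rho_pos by simp

lemma norm_e_dominates: "(norm v / \<rho>) *\<^sub>R e + v \<in> C"
proof (cases "v = 0")
  case True
  then show ?thesis using scale_C[OF e_in_C, of 0] by simp
next
  case False
  then have "(norm v / \<rho>) *\<^sub>R (e + (\<rho> / norm v) *\<^sub>R v) \<in> C"
    using rho_pos by (intro scale_C ball_C) auto
  then show ?thesis
    using False rho_pos by (simp add: scaleR_add_right)
qed

text \<open>This is the nonlinear scalarizing functional of Gerstewitz and Tammer in direction \<open>e\<close>, with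
  base point \<open>0\<close>.\<close>

definition cone_gauge :: "'b \<Rightarrow> real" where
  "cone_gauge y = Inf {t. t *\<^sub>R e - y \<in> C}"

text \<open>The infimum is attained: the set of admissible \<open>t\<close> is closed, closed upwards, contains
  \<open>norm y / \<rho>\<close>, and is bounded below because an admissible \<open>t < - norm y / \<rho>\<close> would put a negative
  multiple of \<open>e\<close> into \<open>C\<close>. All properties of the functional are read off from this
  equivalence.\<close>

lemma cone_gauge_le_iff: "cone_gauge y \<le> t \<longleftrightarrow> t *\<^sub>R e - y \<in> C"
proof -
  define S where "S = {t. t *\<^sub>R e - y \<in> C}"
  have up: "u \<in> S" if "t \<in> S" "t \<le> u" for t u
  proof -
    have "(t *\<^sub>R e - y) + (u - t) *\<^sub>R e \<in> C"
      using that by (intro add_C scale_C e_in_C) (auto simp: S_def)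
    then show ?thesis by (simp add: S_def algebra_simps)
  qed
  have "norm y / \<rho> \<in> S"
    using norm_e_dominates[of "- y"] by (simp add: S_def)
  moreover have low: "- (norm y / \<rho>) \<le> t" if "t \<in> S" for t
  proof (rule ccontr)
    assume "\<not> ?thesis"
    then have neg: "0 < - (t + norm y / \<rho>)" by simp
    have "(t *\<^sub>R e - y) + ((norm y / \<rho>) *\<^sub>R e + y) \<in> C"
      using that by (intro add_C norm_e_dominates) (auto simp: S_def)
    then have "(t + norm y / \<rho>) *\<^sub>R e \<in> C"
      by (simp add: algebra_simps)
    then have "inverse (- (t + norm y / \<rho>)) *\<^sub>R (t + norm y / \<rho>) *\<^sub>R e \<in> C"
      by (rule scale_C) (use neg in simp)
    moreover have "inverse (- (t + norm y / \<rho>)) *\<^sub>R (t + norm y / \<rho>) *\<^sub>R e = - e"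
      using neg by (simp only: scaleR_scaleR inverse_minus_eq mult_minus_left left_inverse) simp
    ultimately show False
      using minus_e by simp
  qed
  moreover have "closed S"
  proof -
    have "closed ((\<lambda>t. t *\<^sub>R e - y) -` C)"
      by (intro closed_vimage closed_C continuous_intros)
    then show ?thesis by (simp add: S_def vimage_def)
  qed
  ultimately have "Inf S \<in> S"
    by (intro closed_contains_Inf bdd_belowI[of _ "- (norm y / \<rho>)"]) auto
  moreover have "Inf S \<le> t" if "t \<in> S" for t
    using that low by (intro cInf_lower bdd_belowI[of _ "- (norm y / \<rho>)"]) auto
  ultimately have "Inf S \<le> t \<longleftrightarrow> t \<in> S"
    using up by blast
  then show ?thesis
    by (simp add: cone_gauge_def S_def)
qed

lemma cone_gauge_attained: "cone_gauge y *\<^sub>R e - y \<in> C"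
  using cone_gauge_le_iff[of y "cone_gauge y"] by simp

lemma cone_gauge_add_le: "cone_gauge (y + z) \<le> cone_gauge y + cone_gauge z"
  unfolding cone_gauge_le_iff using add_C[OF cone_gauge_attained cone_gauge_attained, of y z]
  by (simp add: algebra_simps)

lemma cone_gauge_scale_le: "0 \<le> t \<Longrightarrow> cone_gauge (t *\<^sub>R y) \<le> t * cone_gauge y"
  unfolding cone_gauge_le_iff using scale_C[OF cone_gauge_attained, of t y] by (simp add: algebra_simps)

lemma cone_gauge_mono: "z - y \<in> C \<Longrightarrow> cone_gauge y \<le> cone_gauge z"
  unfolding cone_gauge_le_iff using add_C[OF cone_gauge_attained, of "z - y" z] by simp

lemma cone_gauge_le_norm: "cone_gauge y \<le> norm y / \<rho>"
  unfolding cone_gauge_le_iff using norm_e_dominates[of "- y"] by simp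

lemma cone_gauge_Lipschitz: "cone_gauge y \<le> cone_gauge z + norm (y - z) / \<rho>"
  using cone_gauge_add_le[of z "y - z"] cone_gauge_le_norm[of "y - z"] by simp

lemma cone_gauge_shift: "cone_gauge (y + t *\<^sub>R e) = cone_gauge y + t"
proof (rule order_antisym)
  show "cone_gauge (y + t *\<^sub>R e) \<le> cone_gauge y + t"
    unfolding cone_gauge_le_iff using cone_gauge_attained[of y] by (simp add: algebra_simps)
  have "cone_gauge y \<le> cone_gauge (y + t *\<^sub>R e) - t"
    unfolding cone_gauge_le_iff using cone_gauge_attained[of "y + t *\<^sub>R e"] by (simp add: algebra_simps)
  then show "cone_gauge y + t \<le> cone_gauge (y + t *\<^sub>R e)" by simp
qed

lemma convex_on_gauge_comp:
  assumes "cone_convex C f"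
  shows "convex_on UNIV (\<lambda>x. cone_gauge (f x))"
proof (rule convex_onI)
  fix t :: real and x y assume t: "0 < t" "t < 1"
  have "(1 - t) *\<^sub>R f x + t *\<^sub>R f y - f ((1 - t) *\<^sub>R x + t *\<^sub>R y) \<in> C"
    using assms[unfolded cone_convex_def, rule_format, of "1 - t" x y] t
    by (simp add: mem_below_iff)
  then have "cone_gauge (f ((1 - t) *\<^sub>R x + t *\<^sub>R y)) \<le> cone_gauge ((1 - t) *\<^sub>R f x + t *\<^sub>R f y)"
    by (rule cone_gauge_mono)
  also have "\<dots> \<le> (1 - t) * cone_gauge (f x) + t * cone_gauge (f y)"
    using cone_gauge_add_le[of "(1 - t) *\<^sub>R f x" "t *\<^sub>R f y"] t
      cone_gauge_scale_le[of "1 - t" "f x"] cone_gauge_scale_le[of t "f y"] by linarith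
  finally show "cone_gauge (f ((1 - t) *\<^sub>R x + t *\<^sub>R y)) \<le> (1 - t) * cone_gauge (f x) + t * cone_gauge (f y)" .
qed auto

lemma closed_gauge_comp_sublevel:
  assumes "cone_lsc C f"
  shows "closed {x. cone_gauge (f x - y) \<le> t}"
proof -
  have "{x. cone_gauge (f x - y) \<le> t} = level_set C f (y + t *\<^sub>R e)"
    unfolding cone_gauge_le_iff level_set_def mem_below_iff by (simp add: algebra_simps)
  then show ?thesis
    using assms by (simp add: cone_lsc_def)
qed

lemma cone_convex_add_scalar:
  fixes f :: "'a::real_vector \<Rightarrow> 'b" and h :: "'a \<Rightarrow> real"
  assumes "cone_convex C f" "convex_on UNIV h"
  shows "cone_convex C (\<lambda>x. f x + h x *\<^sub>R e)"
  unfolding cone_convex_def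
proof (intro allI ballI)
  fix x z :: 'a and t :: real assume t: "t \<in> {0..1}"
  let ?w = "t *\<^sub>R x + (1 - t) *\<^sub>R z"
  have "t *\<^sub>R f x + (1 - t) *\<^sub>R f z - f ?w \<in> C"
    using assms(1) t by (auto simp: cone_convex_def mem_below_iff)
  moreover have "h ?w \<le> t * h x + (1 - t) * h z"
    using convex_onD[OF assms(2), of "1 - t" x z] t by simp
  then have "(t * h x + (1 - t) * h z - h ?w) *\<^sub>R e \<in> C"
    by (intro scale_C e_in_C) simp
  ultimately have "(t *\<^sub>R f x + (1 - t) *\<^sub>R f z - f ?w)
      + (t * h x + (1 - t) * h z - h ?w) *\<^sub>R e \<in> C"
    by (rule add_C)
  then show "f ?w + h ?w *\<^sub>R e
      \<in> below C (t *\<^sub>R (f x + h x *\<^sub>R e) + (1 - t) *\<^sub>R (f z + h z *\<^sub>R e))"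
    by (simp add: mem_below_iff algebra_simps)
qed

text \<open>Membership in a level set is one scalar inequality for \<open>cone_gauge (f x - y)\<close>, and in that form
  the summand \<open>h x e\<close> becomes the number \<open>h x\<close>.\<close>

lemma cone_lsc_add_scalar:
  fixes f :: "'a::topological_space \<Rightarrow> 'b" and h :: "'a \<Rightarrow> real"
  assumes "cone_lsc C f" "continuous_on UNIV h"
  shows "cone_lsc C (\<lambda>x. f x + h x *\<^sub>R e)"
  unfolding cone_lsc_def
proof
  fix y
  have "level_set C (\<lambda>x. f x + h x *\<^sub>R e) y = {x. cone_gauge (f x - y + h x *\<^sub>R e) \<le> 0}"
    unfolding cone_gauge_le_iff level_set_def mem_below_iff by (simp add: algebra_simps)
  also have "\<dots> = {x. cone_gauge (f x - y) + h x \<le> 0}"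
    by (simp only: cone_gauge_shift)
  also have "closed \<dots>"
    by (rule closed_sublevel_add[OF closed_gauge_comp_sublevel[OF assms(1)] assms(2)])
  finally show "closed (level_set C (\<lambda>x. f x + h x *\<^sub>R e) y)" .
qed

text \<open>If \<open>f x\<close> lies below \<open>f xbar + \<alpha> c\<close>, then \<open>cone_gauge (f x)\<close> exceeds \<open>cone_gauge (f xbar)\<close> by at most
  \<open>\<alpha> norm c / \<rho>\<close>; so every vector level set is contained in a scalar one, and small \<open>\<alpha>\<close> make it small.
  The case \<open>c = 0\<close> gives efficiency.\<close>

lemma well_posed_if_gauge_Tykhonov:
  fixes f :: "'a::real_normed_vector \<Rightarrow> 'b"
  assumes wp: "\<And>\<epsilon>. 0 < \<epsilon> \<Longrightarrow> \<exists>\<eta>>0. \<forall>x. cone_gauge (f x) < cone_gauge (f xbar) + \<eta> \<longrightarrow> dist x xbar < \<epsilon>"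
  shows "xbar \<in> efficient C f" and "DH_well_posed_at C f xbar"
proof -
  have uniq: "x = xbar" if "cone_gauge (f x) \<le> cone_gauge (f xbar)" for x
  proof (rule ccontr)
    assume "x \<noteq> xbar"
    then obtain \<eta> where "0 < \<eta>" "\<And>z. cone_gauge (f z) < cone_gauge (f xbar) + \<eta> \<Longrightarrow> dist z xbar < dist x xbar"
      using wp[of "dist x xbar"] by auto
    with that show False by (metis add.commute add_strict_increasing order_less_irrefl)
  qed
  have "f x - f xbar = 0" if "- (f x - f xbar) \<in> C" for x
    using uniq[of x] cone_gauge_mono[of "f xbar" "f x"] that by simp
  moreover have "0 \<in> C"
    using scale_C[OF e_in_C, of 0] by simp
  ultimately have "range (\<lambda>x. f x - f xbar) \<inter> uminus ` C = {0}"
    by (auto simp: image_iff) (metis add.inverse_inverse diff_self minus_diff_eq right_minus_eq)+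
  then show "xbar \<in> efficient C f"
    by (simp add: efficient_def)
  show "DH_well_posed_at C f xbar"
    unfolding DH_well_posed_at_def
  proof
    fix c assume "c \<in> C"
    have "(INF \<alpha>\<in>{0::real<..}. ediameter (level_set C f (f xbar + \<alpha> *\<^sub>R c))) \<le> 0"
    proof (rule ennreal_le_epsilon)
      fix \<epsilon> :: real assume "0 < \<epsilon>"
      then obtain \<eta> where \<eta>: "0 < \<eta>" "\<And>x. cone_gauge (f x) < cone_gauge (f xbar) + \<eta> \<Longrightarrow> dist x xbar < \<epsilon> / 2"
        using wp[of "\<epsilon> / 2"] by auto
      define \<alpha> where "\<alpha> = \<eta> * \<rho> / (norm c + 1)"
      have \<alpha>: "0 < \<alpha>" "\<alpha> * norm c / \<rho> < \<eta>"
        using \<eta>(1) rho_pos norm_ge_zero[of c]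
        by (simp_all add: \<alpha>_def pos_divide_less_eq add_nonneg_pos)
      have near: "dist x xbar < \<epsilon> / 2" if "x \<in> level_set C f (f xbar + \<alpha> *\<^sub>R c)" for x
      proof (rule \<eta>)
        have "cone_gauge (f x) \<le> cone_gauge (f xbar + \<alpha> *\<^sub>R c)"
          using that by (intro cone_gauge_mono) (simp add: level_set_def mem_below_iff)
        also have "\<dots> \<le> cone_gauge (f xbar) + \<alpha> * norm c / \<rho>"
          using cone_gauge_Lipschitz[of "f xbar + \<alpha> *\<^sub>R c" "f xbar"] \<alpha> by simp
        finally show "cone_gauge (f x) < cone_gauge (f xbar) + \<eta>"
          using \<alpha> by simp
      qed
      have "ediameter (level_set C f (f xbar + \<alpha> *\<^sub>R c)) \<le> ennreal \<epsilon>"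
        unfolding ediameter_def
      proof (intro SUP_least ennreal_leI)
        fix x y assume "x \<in> level_set C f (f xbar + \<alpha> *\<^sub>R c)" "y \<in> level_set C f (f xbar + \<alpha> *\<^sub>R c)"
        then show "norm (x - y) \<le> \<epsilon>"
          using near dist_triangle_half_l[of x xbar \<epsilon> y] by (simp add: dist_norm less_imp_le)
      qed
      then show "(INF \<alpha>\<in>{0::real<..}. ediameter (level_set C f (f xbar + \<alpha> *\<^sub>R c))) \<le> 0 + ennreal \<epsilon>"
        using \<alpha> by (auto intro: INF_lower2)
    qed
    then show "(INF \<alpha>\<in>{0::real<..}. ediameter (level_set C f (f xbar + \<alpha> *\<^sub>R c))) = 0"
      by simp
  qed
qed

section \<open>Maps whose scalarization has a gap on a small sphere\<close>

definition sphere_gap_maps :: "real \<Rightarrow> ('a::real_normed_vector \<Rightarrow> 'b) set" where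
  "sphere_gap_maps r = {f \<in> convex_lsc_maps C.
     \<exists>a. \<exists>\<alpha>>0. \<forall>z. dist z a = r \<longrightarrow> cone_gauge (f a) + \<alpha> \<le> cone_gauge (f z)}"

text \<open>The sphere and its centre lie in one ball, and \<open>cone_gauge\<close> is Lipschitz with constant
  \<open>1 / \<rho>\<close>: a map that is uniformly within \<open>\<alpha> \<rho> / 4\<close> of \<open>f\<close> on that ball loses at most half of the gap.\<close>

lemma openin_sphere_gap_maps:
  "openin (map_topology \<theta> C) (sphere_gap_maps r :: ('a::real_normed_vector \<Rightarrow> 'b) set)"
proof -
  interpret M: Metric_space "convex_lsc_maps C :: ('a \<Rightarrow> 'b) set" "bounded_dist \<theta>"
    by (rule Metric_space_bounded_dist)
  have "\<exists>\<epsilon>>0. M.mball f \<epsilon> \<subseteq> sphere_gap_maps r" if f: "f \<in> sphere_gap_maps r" for f :: "'a \<Rightarrow> 'b"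
  proof -
    obtain a \<alpha> where \<alpha>: "0 < \<alpha>" "\<And>z. dist z a = r \<Longrightarrow> cone_gauge (f a) + \<alpha> \<le> cone_gauge (f z)"
      using f by (auto simp: sphere_gap_maps_def)
    have "0 < \<alpha> * \<rho> / 4"
      using \<alpha> rho_pos by simp
    then obtain \<epsilon> where \<epsilon>: "0 < \<epsilon>" "\<And>f g :: 'a \<Rightarrow> 'b. \<And>x. bounded_dist \<theta> f g < \<epsilon> \<Longrightarrow>
        norm (x - \<theta>) \<le> norm (a - \<theta>) + \<bar>r\<bar> \<Longrightarrow> norm (f x - g x) < \<alpha> * \<rho> / 4"
      using bounded_dist_less_imp_close_on_ball[where 'a = 'a and 'b = 'b] by blast
    have "g \<in> sphere_gap_maps r" if g: "g \<in> M.mball f \<epsilon>" for g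
    proof -
      have close: "norm (f x - g x) / \<rho> < \<alpha> / 4" if "norm (x - a) \<le> \<bar>r\<bar>" for x
      proof -
        have "norm (x - \<theta>) \<le> norm (a - \<theta>) + \<bar>r\<bar>"
          using that norm_triangle_ineq[of "x - a" "a - \<theta>"] by simp
        then have "norm (f x - g x) < \<alpha> * \<rho> / 4"
          using \<epsilon>(2)[of f g x] g by simp
        then show ?thesis
          using rho_pos by (simp add: field_simps)
      qed
      have "cone_gauge (g a) + \<alpha> / 2 \<le> cone_gauge (g z)" if z: "dist z a = r" for z
      proof -
        have "norm (g a - f a) / \<rho> < \<alpha> / 4" "norm (f z - g z) / \<rho> < \<alpha> / 4"
          using close[of a] close[of z] z by (simp_all add: dist_norm norm_minus_commute)
        then show ?thesis
          using \<alpha>(2)[OF z]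
            cone_gauge_Lipschitz[of "g a" "f a"] cone_gauge_Lipschitz[of "f z" "g z"]
          by linarith
      qed
      then show ?thesis
        using g \<alpha>(1) unfolding sphere_gap_maps_def M.in_mball
        by (auto intro!: exI[of _ a] exI[of _ "\<alpha> / 2"])
    qed
    with \<epsilon>(1) show ?thesis by blast
  qed
  then show ?thesis
    unfolding map_topology_def M.openin_mtopology by (auto simp: sphere_gap_maps_def)
qed

lemma sphere_gap_maps_well_posed:
  fixes f :: "'a::banach \<Rightarrow> 'b"
  assumes "\<And>n. f \<in> sphere_gap_maps (inverse (real (Suc n)))"
  shows "f \<in> well_posed_maps C"
proof -
  have f: "f \<in> convex_lsc_maps C"
    using assms by (auto simp: sphere_gap_maps_def)
  then have fC: "cone_convex C f" "cone_lsc C f"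
    by (auto simp: convex_lsc_maps_def)
  have gaps: "\<exists>a. \<exists>\<alpha>>0. \<forall>z. dist z a = inverse (real (Suc n)) \<longrightarrow>
      cone_gauge (f a) + \<alpha> \<le> cone_gauge (f z)" for n
    using assms[of n] unfolding sphere_gap_maps_def by blast
  obtain xbar where "\<And>\<epsilon>. 0 < \<epsilon> \<Longrightarrow>
      \<exists>\<eta>>0. \<forall>x. cone_gauge (f x) < cone_gauge (f xbar) + \<eta> \<longrightarrow> dist x xbar < \<epsilon>"
    by (rule Tykhonov_well_posed_if_sphere_gaps[of "\<lambda>x. cone_gauge (f x)",
          OF convex_on_gauge_comp[OF fC(1)] closed_gauge_comp_sublevel[OF fC(2), of 0, simplified]
            gaps]) blast
  from well_posed_if_gauge_Tykhonov[OF this] f show ?thesis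
    by (auto simp: well_posed_maps_def)
qed

text \<open>A single \<open>g\<close> near \<open>f\<close> has the gap for all radii at once, because its scalarization has a
  sharp minimum; this makes the intersection of the open sets dense, and not only each of them.\<close>

lemma sphere_gap_maps_dense:
  fixes f :: "'a::banach \<Rightarrow> 'b"
  assumes f: "f \<in> convex_lsc_maps C" and "0 < \<epsilon>"
  obtains g where "bounded_dist \<theta> f g < \<epsilon>" "\<And>r. 0 < r \<Longrightarrow> g \<in> sphere_gap_maps r"
proof -
  have fC: "cone_convex C f" "cone_lsc C f"
    using f by (auto simp: convex_lsc_maps_def)
  obtain N where N: "(1/2::real) ^ N < \<epsilon> / 2"
    using real_arch_pow_inv[of "\<epsilon> / 2" "1/2"] \<open>0 < \<epsilon>\<close> by auto
  define \<delta> where "\<delta> = \<epsilon> / (2 * (norm e + 1))"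
  have \<delta>: "0 < \<delta>" "\<delta> * norm e \<le> \<epsilon> / 2"
    using \<open>0 < \<epsilon>\<close> norm_ge_zero[of e]
    by (simp_all add: \<delta>_def pos_divide_le_eq add_nonneg_pos)
  obtain h a \<kappa> where h: "convex_on UNIV h" "continuous_on UNIV h" "\<And>x. 0 \<le> h x"
    "\<And>x. dist x \<theta> \<le> real N \<Longrightarrow> h x \<le> \<delta>" "\<And>R. \<exists>B. \<forall>x. dist x \<theta> \<le> R \<longrightarrow> h x \<le> B"
    and \<kappa>: "0 < \<kappa>" "\<And>x. cone_gauge (f a) + h a + \<kappa> * dist x a \<le> cone_gauge (f x) + h x"
    by (rule sharp_minimum_perturbation[of "\<lambda>x. cone_gauge (f x)" "real N" \<delta> \<theta>,
          OF convex_on_gauge_comp[OF fC(1)] closed_gauge_comp_sublevel[OF fC(2), of 0, simplified]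
            of_nat_0_le_iff \<delta>(1)]) blast
  define g where "g x = f x + h x *\<^sub>R e" for x
  have diff: "norm (f x - g x) = h x * norm e" for x
    using h(3)[of x] by (simp add: g_def)
  show thesis
  proof (rule that[of g])
    have "bounded_dist \<theta> f g \<le> \<delta> * norm e + (1/2) ^ N"
    proof (rule bounded_dist_le_if_close_on_ball)
      show "\<exists>B. \<forall>x. norm (x - \<theta>) \<le> R \<longrightarrow> norm (f x - g x) \<le> B" for R
        using h(5)[of R] unfolding diff dist_norm by (blast intro: mult_right_mono norm_ge_zero)
      show "norm (f x - g x) \<le> \<delta> * norm e" if "norm (x - \<theta>) \<le> real N" for x
        unfolding diff using that h(4)[of x] by (intro mult_right_mono) (auto simp: dist_norm)
    qed (use \<delta> in auto)
    with \<delta> N show "bounded_dist \<theta> f g < \<epsilon>" by linarith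
    have "g \<in> convex_lsc_maps C"
      unfolding convex_lsc_maps_def g_def
      using cone_convex_add_scalar[OF fC(1) h(1)] cone_lsc_add_scalar[OF fC(2) h(2)] by simp
    moreover have "cone_gauge (g a) + \<kappa> * dist z a \<le> cone_gauge (g z)" for z
      using \<kappa>(2)[of z] by (simp add: g_def cone_gauge_shift)
    ultimately show "g \<in> sphere_gap_maps r" if "0 < r" for r
      using that \<kappa>(1) unfolding sphere_gap_maps_def
      by (auto intro!: exI[of _ a] exI[of _ "\<kappa> * r"])
  qed
qed

end

text \<open>If both \<open>e\<close> and \<open>- e\<close> were in \<open>C\<close>, then \<open>e = 0\<close> by pointedness; a ball around \<open>0\<close> inside \<open>C\<close>
  would contain a nonzero vector together with its opposite, unless the space is trivial.\<close>

lemma solid_cone_of_interior_point: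
  fixes C :: "'b::real_normed_vector set"
  assumes "(UNIV :: 'b set) \<noteq> {0}" "closed C" "convex C" "pointed_cone C" "interior C \<noteq> {}"
  obtains e \<rho> where "solid_cone C e \<rho>"
proof -
  have cone: "cone C" and pointed: "C \<inter> uminus ` C = {0}"
    using assms(4) by (auto simp: pointed_cone_def)
  obtain e \<rho> where \<rho>: "0 < \<rho>" "cball e \<rho> \<subseteq> C"
    using assms(5) by (auto simp: mem_interior_cball)
  have ball: "e + v \<in> C" if "norm v \<le> \<rho>" for v
    using \<rho>(2) that by (auto simp: subset_iff dist_norm)
  have "- e \<notin> C"
  proof
    assume "- e \<in> C"
    moreover have "e \<in> C"
      using ball[of 0] \<rho>(1) by simp
    ultimately have "e \<in> C \<inter> uminus ` C"
      by (auto intro!: image_eqI[of e uminus "- e"])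
    then have "e = 0"
      using pointed by blast
    obtain v :: 'b where "v \<noteq> 0"
      using assms(1) by auto
    define w where "w = (\<rho> / norm v) *\<^sub>R v"
    have "norm w = \<rho>"
      using \<open>v \<noteq> 0\<close> \<rho>(1) by (simp add: w_def)
    then have "w \<in> C" "- w \<in> C"
      using ball[of w] ball[of "- w"] \<open>e = 0\<close> by auto
    then have "w \<in> C \<inter> uminus ` C"
      by (auto intro!: image_eqI[of w uminus "- w"])
    then have "w = 0"
      using pointed by blast
    with \<open>norm w = \<rho>\<close> \<rho>(1) show False by simp
  qed
  moreover have "y + z \<in> C" if "y \<in> C" "z \<in> C" for y z
    using convex_cone[of C] cone assms(3) that by blast
  moreover have "t *\<^sub>R y \<in> C" if "y \<in> C" "0 \<le> t" for y t
    using cone that by (auto simp: cone_def)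
  ultimately have "solid_cone C e \<rho>"
    using assms(2) \<rho>(1) ball by unfold_locales auto
  then show thesis by (rule that)
qed

theorem theorem5p3:
  fixes C :: "'b::banach set" and \<theta> :: "'a::banach"
  assumes "(UNIV :: 'b set) \<noteq> {0}"
    and "closed C" and "convex C" and "pointed_cone C" and "interior C \<noteq> {}"
  shows "\<exists>G :: ('a \<Rightarrow> 'b) set. G \<subseteq> well_posed_maps C
    \<and> gdelta_in (map_topology \<theta> C) G
    \<and> (map_topology \<theta> C) closure_of G = convex_lsc_maps C"
proof -
  obtain e \<rho> where "solid_cone C e \<rho>"
    using solid_cone_of_interior_point[OF assms] .
  then interpret solid_cone C e \<rho> .
  interpret M: Metric_space "convex_lsc_maps C :: ('a \<Rightarrow> 'b) set" "bounded_dist \<theta>"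
    by (rule Metric_space_bounded_dist)
  define G :: "('a \<Rightarrow> 'b) set" where "G = (\<Inter>n. sphere_gap_maps (inverse (real (Suc n))))"
  have "G \<subseteq> well_posed_maps C"
    unfolding G_def by (intro subsetI sphere_gap_maps_well_posed) blast
  moreover have "gdelta_in (map_topology \<theta> C) G"
    unfolding G_def
    by (rule gdelta_in_Inter) (auto intro: open_imp_gdelta_in openin_sphere_gap_maps)
  moreover have "\<exists>g\<in>G. g \<in> M.mball f \<epsilon>" if f: "f \<in> convex_lsc_maps C" "0 < \<epsilon>" for f \<epsilon>
  proof -
    obtain g where g: "bounded_dist \<theta> f g < \<epsilon>" "\<And>r. 0 < r \<Longrightarrow> g \<in> sphere_gap_maps r"
      using sphere_gap_maps_dense[where \<theta> = \<theta>, OF f] by blast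
    have "g \<in> G"
      unfolding G_def by (auto intro: g(2))
    moreover have "g \<in> convex_lsc_maps C"
      using g(2)[of 1] by (simp add: sphere_gap_maps_def)
    ultimately show ?thesis
      using g(1) f(1) by auto
  qed
  then have "(map_topology \<theta> C) closure_of G = convex_lsc_maps C"
    unfolding map_topology_def M.metric_closure_of by auto
  ultimately show ?thesis by blast
qed

end
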